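(* Let $X$ be a Tychonoff space. Then $X$ is nearly pseudocompact if and only if $X$ does not contain any $C$-embedded copy of $\mathbb{N}$ which is hard in $X$; that is, if and only if there is no subspace $D \subseteq X$ such that $D$ is homeomorphic to the discrete space $\mathbb{N}$, $D$ is $C$-embedded in $X$, and $D$ is hard in $X$.
   Context: All spaces are Tychonoff (completely regular Hausdorff). $C(X)$ denotes the ring of all real-valued continuous functions on $X$. $\beta X$ denotes the Stone–Čech compactification of $X$ and $\upsilon X$ the Hewitt realcompactification of $X$, regarded as a subspace with $X \subseteq \upsilon X \subseteq \beta X$. The space $X$ is called nearly pseudocompact if $\upsilon X \setminus X$ is dense in $\beta X \setminus X$. A subspace $H$ of $X$ is called hard in $X$ if $H$ is closed in $X \cup K$ (with the subspace topology from $\beta X$), where $K = \mathrm{cl}_{\beta X}(\upsilon X \setminus X)$. A subset $Y \subseteq X$ is $C$-embedded in $X$ if for every $f \in C(Y)$ there exists $g \in C(X)$ with $g(y) = f(y)$ for all $y \in Y$. $\mathbb{N}$ carries the discrete topology. *)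

theory Defs
  imports "HOL-Analysis.Analysis"
begin

definition tychonoff_space :: "'a topology \<Rightarrow> bool" where
  "tychonoff_space X \<longleftrightarrow> completely_regular_space X \<and> Hausdorff_space X"

definition C_embedded_in :: "'a topology \<Rightarrow> 'a set \<Rightarrow> bool" where
  "C_embedded_in X Y \<longleftrightarrow> Y \<subseteq> topspace X \<and>
     (\<forall>f. continuous_map (subtopology X Y) euclideanreal f \<longrightarrow>
          (\<exists>g. continuous_map X euclideanreal g \<and> (\<forall>y\<in>Y. g y = f y)))"


section \<open>The Stone--Cech compactification\<close>

text \<open>The compactification is the closure of the image of the space in the Tychonoff cube whose
  coordinates are the continuous functions into the unit interval. Functions are taken extensional
  so that functions agreeing on the space give a single coordinate.\<close>

definition unit_maps :: "'a topology \<Rightarrow> ('a \<Rightarrow> real) set" where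
  "unit_maps X = {f. f \<in> extensional (topspace X) \<and> continuous_map X (top_of_set {0..1}) f}"

definition unit_cube :: "'a topology \<Rightarrow> (('a \<Rightarrow> real) \<Rightarrow> real) topology" where
  "unit_cube X = product_topology (\<lambda>_. top_of_set {0..1}) (unit_maps X)"

definition sc_embed :: "'a topology \<Rightarrow> 'a \<Rightarrow> ('a \<Rightarrow> real) \<Rightarrow> real" where
  "sc_embed X x = (\<lambda>f\<in>unit_maps X. f x)"

definition stone_cech :: "'a topology \<Rightarrow> (('a \<Rightarrow> real) \<Rightarrow> real) topology" where
  "stone_cech X = subtopology (unit_cube X) (unit_cube X closure_of (sc_embed X ` topspace X))"

abbreviation sc_image :: "'a topology \<Rightarrow> (('a \<Rightarrow> real) \<Rightarrow> real) set" where
  "sc_image X \<equiv> sc_embed X ` topspace X"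


section \<open>The Hewitt realcompactification\<close>

text \<open>The Hewitt realcompactification is the largest subspace of the compactification in which the
  space is C-embedded. The lemmas \<open>C_embedded_in_iff_hewitt\<close> and \<open>realcompact_hewitt\<close> show that
  the union below is itself such a subspace and is realcompact.\<close>

definition hewitt :: "'a topology \<Rightarrow> (('a \<Rightarrow> real) \<Rightarrow> real) set" where
  "hewitt X = \<Union>{T. sc_image X \<subseteq> T \<and> T \<subseteq> topspace (stone_cech X) \<and>
                   C_embedded_in (subtopology (stone_cech X) T) (sc_image X)}"


section \<open>Nearly pseudocompact spaces and hard subspaces\<close>

definition nearly_pseudocompact :: "'a topology \<Rightarrow> bool" where
  "nearly_pseudocompact X \<longleftrightarrow>
     (let R = topspace (stone_cech X) - sc_image X
      in subtopology (stone_cech X) R closure_of (hewitt X - sc_image X) = R)"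

definition hard_in :: "'a topology \<Rightarrow> 'a set \<Rightarrow> bool" where
  "hard_in X H \<longleftrightarrow> H \<subseteq> topspace X \<and>
     (let K = stone_cech X closure_of (hewitt X - sc_image X)
      in closedin (subtopology (stone_cech X) (sc_image X \<union> K)) (sc_embed X ` H))"


section \<open>Characteristic properties of the two extensions\<close>

lemma unit_cube_compact_Hausdorff: "compact_space (unit_cube X)" "Hausdorff_space (unit_cube X)"
  by (auto simp: unit_cube_def compact_space_product_topology Hausdorff_space_product_topology
        compact_space_subtopology Hausdorff_space_subtopology)

lemma compact_space_stone_cech: "compact_space (stone_cech X)"
  by (simp add: stone_cech_def closedin_compact_space compact_space_subtopology
        unit_cube_compact_Hausdorff)

lemma Hausdorff_space_stone_cech: "Hausdorff_space (stone_cech X)"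
  by (simp add: stone_cech_def Hausdorff_space_subtopology unit_cube_compact_Hausdorff)

lemma continuous_map_sc_embed_cube: "continuous_map X (unit_cube X) (sc_embed X)"
proof -
  have "continuous_map X (top_of_set {0..1}) (\<lambda>x. sc_embed X x f)" if "f \<in> unit_maps X" for f
    using that by (simp add: sc_embed_def unit_maps_def)
  then show ?thesis
    unfolding unit_cube_def continuous_map_componentwise by (auto simp: sc_embed_def)
qed

lemma sc_image_subset_cube: "sc_image X \<subseteq> topspace (unit_cube X)"
  by (rule continuous_map_image_subset_topspace[OF continuous_map_sc_embed_cube])

lemma topspace_stone_cech: "topspace (stone_cech X) = unit_cube X closure_of sc_image X"
  by (simp add: stone_cech_def closure_of_subset_topspace inf.absorb2)

lemma sc_image_subset: "sc_image X \<subseteq> topspace (stone_cech X)"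
  by (simp add: topspace_stone_cech closure_of_subset sc_image_subset_cube)

lemma sc_image_dense: "stone_cech X closure_of sc_image X = topspace (stone_cech X)"
  using sc_image_subset[of X] unfolding topspace_stone_cech
  by (simp add: stone_cech_def closure_of_subtopology inf.absorb2)

lemma embedding_map_sc_embed:
  assumes "tychonoff_space X"
  shows "embedding_map X (stone_cech X) (sc_embed X)"
proof -
  have "unit_maps X = mspace (submetric (cfunspace X euclidean_metric) {f. f \<in> topspace X \<rightarrow> {0..1}})"
    by (auto simp: unit_maps_def continuous_map_in_subtopology 
        intro!: bounded_subset[OF bounded_closed_interval[of 0 1]])
  then have "embedding_map X (unit_cube X) (sc_embed X)"
    using completely_regular_space_cube_embedding_explicit[of X] assms
    by (simp add: tychonoff_space_def unit_cube_def sc_embed_def[abs_def])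
  then show ?thesis
    using sc_image_subset[of X]
    by (simp add: stone_cech_def embedding_map_in_subtopology topspace_stone_cech)
qed

lemma continuous_map_sc_embed: "continuous_map X (stone_cech X) (sc_embed X)"
  using sc_image_subset[of X] unfolding topspace_stone_cech
  by (auto simp: stone_cech_def continuous_map_in_subtopology continuous_map_sc_embed_cube)

text \<open>Every continuous map into a compact Hausdorff space extends to the compactification; the
  extension is unique because the image is dense.\<close>

lemma stone_cech_extension:
  fixes X :: "'a topology" and Z :: "'b topology"
  assumes Z: "compact_space Z" "Hausdorff_space Z" and f: "continuous_map X Z f"
  obtains g where "continuous_map (stone_cech X) Z g" "\<And>x. x \<in> topspace X \<Longrightarrow> g (sc_embed X x) = f x"
proof -
  have tZ: "tychonoff_space Z"
    using Z by (simp add: tychonoff_space_def compact_Hausdorff_or_regular_imp_normal_space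
        normal_imp_completely_regular_space)
  have emb: "embedding_map Z (unit_cube Z) (sc_embed Z)"
    using embedding_map_sc_embed[OF tZ]
    by (simp add: stone_cech_def embedding_map_in_subtopology)
  define F :: "(('a \<Rightarrow> real) \<Rightarrow> real) \<Rightarrow> ('b \<Rightarrow> real) \<Rightarrow> real" where
    "F = (\<lambda>p. \<lambda>h\<in>unit_maps Z. p (restrict (h \<circ> f) (topspace X)))"
  have comp: "restrict (h \<circ> f) (topspace X) \<in> unit_maps X" if "h \<in> unit_maps Z" for h
  proof -
    have "continuous_map X (top_of_set {0..1}) (h \<circ> f)"
      using that f by (auto simp: unit_maps_def intro: continuous_map_compose)
    then show ?thesis
      by (auto simp: unit_maps_def intro: continuous_map_eq)
  qed
  have contF: "continuous_map (unit_cube X) (unit_cube Z) F"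
    unfolding unit_cube_def F_def continuous_map_componentwise
    by (auto intro: continuous_map_product_projection comp)
  have Fe: "F (sc_embed X x) = sc_embed Z (f x)" if "x \<in> topspace X" for x
    using that comp by (auto simp: F_def sc_embed_def fun_eq_iff)
  have "closedin (unit_cube Z) (sc_image Z)"
    by (meson Z(1) compact_space_def compactin_imp_closedin continuous_map_sc_embed_cube
        image_compactin unit_cube_compact_Hausdorff(2))
  moreover have "F ` sc_image X \<subseteq> sc_image Z"
    using Fe f by (force simp: continuous_map_def)
  ultimately have sub: "F ` topspace (stone_cech X) \<subseteq> sc_image Z"
    using continuous_map_image_closure_subset[OF contF, of "sc_image X"]
      closure_of_minimal[of "F ` sc_image X" "sc_image Z" "unit_cube Z"]
    by (auto simp: topspace_stone_cech)
  obtain k where k: "homeomorphic_maps Z (subtopology (unit_cube Z) (sc_image Z)) (sc_embed Z) k"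
    using emb by (auto simp: embedding_map_def homeomorphic_map_maps)
  have "continuous_map (stone_cech X) (subtopology (unit_cube Z) (sc_image Z)) F"
    using sub contF by (auto simp: stone_cech_def continuous_map_in_subtopology
        continuous_map_from_subtopology)
  then have "continuous_map (stone_cech X) Z (k \<circ> F)"
    using k by (auto simp: homeomorphic_maps_def intro: continuous_map_compose)
  moreover have "(k \<circ> F) (sc_embed X x) = f x" if "x \<in> topspace X" for x
    using that k f Fe by (auto simp: homeomorphic_maps_def continuous_map_def)
  ultimately show thesis
    using that by blast
qed

lemma sc_image_subset_hewitt: "sc_image X \<subseteq> hewitt X"
proof -
  have "C_embedded_in (subtopology (stone_cech X) (sc_image X)) (sc_image X)"
    using sc_image_subset[of X] by (auto simp: C_embedded_in_def subtopology_subtopology)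
  then show ?thesis
    using sc_image_subset[of X] unfolding hewitt_def by blast
qed

lemma hewitt_subset: "hewitt X \<subseteq> topspace (stone_cech X)"
  by (auto simp: hewitt_def)

lemma C_embedded_in_hewitt: "C_embedded_in (subtopology (stone_cech X) (hewitt X)) (sc_image X)"
  unfolding C_embedded_in_def
proof (intro conjI allI impI)
  show "sc_image X \<subseteq> topspace (subtopology (stone_cech X) (hewitt X))"
    using sc_image_subset[of X] sc_image_subset_hewitt[of X] by auto
next
  fix f
  assume "continuous_map (subtopology (subtopology (stone_cech X) (hewitt X)) (sc_image X)) euclideanreal f"
  then have f: "continuous_map (subtopology (stone_cech X) (sc_image X)) euclideanreal f"
    using sc_image_subset_hewitt[of X] by (simp add: subtopology_subtopology inf.absorb2)
  have "\<exists>g. continuous_map (subtopology (stone_cech X) (insert p (sc_image X))) euclideanreal g \<and>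
            (\<forall>x\<in>sc_image X. g x = f x)" if p: "p \<in> hewitt X" for p
  proof -
    obtain T where T: "p \<in> T" "sc_image X \<subseteq> T" 
      "C_embedded_in (subtopology (stone_cech X) T) (sc_image X)"
      using p by (auto simp: hewitt_def)
    then obtain g where g: "continuous_map (subtopology (stone_cech X) T) euclideanreal g"
      "\<forall>x\<in>sc_image X. g x = f x"
      using f by (auto simp: C_embedded_in_def subtopology_subtopology inf.absorb2)
    then show ?thesis
      using T by (meson continuous_map_from_subtopology_mono insert_subset)
  qed
  moreover have "regular_space euclideanreal"
    by (simp add: regular_space_euclidean)
  ultimately obtain g where "continuous_map (subtopology (stone_cech X) (hewitt X)) euclideanreal g"
    "\<And>x. x \<in> sc_image X \<Longrightarrow> g x = f x"
    using continuous_map_extension_pointwise[of euclideanreal "sc_image X" "hewitt X" "stone_cech X" f]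
      sc_image_subset_hewitt[of X] hewitt_subset[of X] sc_image_dense[of X] by metis
  then show "\<exists>g. continuous_map (subtopology (stone_cech X) (hewitt X)) euclideanreal g \<and>
                 (\<forall>y\<in>sc_image X. g y = f y)"
    by blast
qed

lemma C_embedded_in_iff_hewitt:
  assumes "sc_image X \<subseteq> T" "T \<subseteq> topspace (stone_cech X)"
  shows "C_embedded_in (subtopology (stone_cech X) T) (sc_image X) \<longleftrightarrow> T \<subseteq> hewitt X"
proof
  assume "C_embedded_in (subtopology (stone_cech X) T) (sc_image X)"
  then show "T \<subseteq> hewitt X"
    using assms by (auto simp: hewitt_def)
next
  assume T: "T \<subseteq> hewitt X"
  show "C_embedded_in (subtopology (stone_cech X) T) (sc_image X)"
    unfolding C_embedded_in_def
  proof (intro conjI allI impI)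
    show "sc_image X \<subseteq> topspace (subtopology (stone_cech X) T)"
      using assms by auto
  next
    fix f
    assume "continuous_map (subtopology (subtopology (stone_cech X) T) (sc_image X)) euclideanreal f"
    then have "continuous_map (subtopology (subtopology (stone_cech X) (hewitt X)) (sc_image X)) euclideanreal f"
      using assms sc_image_subset_hewitt[of X] by (simp add: subtopology_subtopology inf.absorb2)
    then obtain g where "continuous_map (subtopology (stone_cech X) (hewitt X)) euclideanreal g"
      "\<forall>y\<in>sc_image X. g y = f y"
      using C_embedded_in_hewitt[of X] unfolding C_embedded_in_def by blast
    then show "\<exists>g. continuous_map (subtopology (stone_cech X) T) euclideanreal g \<and>
                   (\<forall>y\<in>sc_image X. g y = f y)"
      using T by (meson continuous_map_from_subtopology_mono)
  qed
qed

text \<open>The subspace is realcompact: it is homeomorphic to a closed subspace of a power of the reals.\<close>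

lemma realcompact_hewitt:
  fixes X :: "'a topology"
  defines "V \<equiv> subtopology (stone_cech X) (hewitt X)"
  defines "C \<equiv> {f. continuous_map V euclideanreal f}"
  defines "P \<equiv> product_topology (\<lambda>_. euclideanreal) C"
  defines "F \<equiv> (\<lambda>v. \<lambda>f\<in>C. f v)"
  shows "embedding_map V P F" "closedin P (F ` topspace V)"
proof -
  have tV: "topspace V = hewitt X"
    using hewitt_subset[of X] by (auto simp: V_def)
  have V_cube: "V = subtopology (unit_cube X) (hewitt X)"
    using hewitt_subset[of X] unfolding topspace_stone_cech
    by (simp add: V_def stone_cech_def subtopology_subtopology inf.absorb2)
  have ext: "v \<in> extensional (unit_maps X)" "\<And>h. h \<in> unit_maps X \<Longrightarrow> v h \<in> {0..1}"
    if "v \<in> topspace (stone_cech X)" for v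
    using that by (auto simp: stone_cech_def unit_cube_def PiE_def Pi_iff)
  have proj_cube: "continuous_map (unit_cube X) euclideanreal (\<lambda>v. v h)" if "h \<in> unit_maps X" for h
    using continuous_map_product_projection[of h "unit_maps X" "\<lambda>_. top_of_set {0..1::real}"] that
    by (simp add: unit_cube_def continuous_map_in_subtopology)
  then have proj_sc: "continuous_map (stone_cech X) euclideanreal (\<lambda>v. v h)" if "h \<in> unit_maps X" for h
    using that by (simp add: stone_cech_def continuous_map_from_subtopology)
  then have proj: "(\<lambda>v. v h) \<in> C" if "h \<in> unit_maps X" for h
    using that by (simp add: C_def V_def continuous_map_from_subtopology)
  have coord: "continuous_map P euclideanreal (\<lambda>q. q f)" if "f \<in> C" for f
    using continuous_map_product_projection[of f C "\<lambda>_. euclideanreal"] that by (simp add: P_def)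
  have contF: "continuous_map V P F"
    unfolding P_def continuous_map_componentwise by (auto simp: F_def C_def)
  have F01: "F v (\<lambda>v. v h) \<in> {0..1}" if "v \<in> hewitt X" "h \<in> unit_maps X" for v h
  proof -
    have "F v (\<lambda>v. v h) = v h"
      unfolding F_def by (rule restrict_apply'[OF proj[OF that(2)]])
    moreover have "v h \<in> {0..1}"
      using ext(2) that hewitt_subset[of X] by blast
    ultimately show ?thesis
      by simp
  qed
  define G where "G = (\<lambda>q. \<lambda>h\<in>unit_maps X. q (\<lambda>v::('a \<Rightarrow> real) \<Rightarrow> real. v h) :: real)"
  have GF: "G (F v) = v" if "v \<in> hewitt X" for v
  proof -
    have "v \<in> extensional (unit_maps X)"
      using that ext(1) hewitt_subset[of X] by blast
    then show ?thesis
      using proj by (auto simp: G_def F_def fun_eq_iff extensional_def)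
  qed
  have contG: "continuous_map (subtopology P S) (unit_cube X) G"
    if S: "\<forall>q\<in>S. \<forall>h\<in>unit_maps X. q (\<lambda>v. v h) \<in> {0..1}" for S
  proof -
    have "continuous_map (subtopology P S) (top_of_set {0..1}) (\<lambda>q. G q h)" if h: "h \<in> unit_maps X" for h
      using coord[OF proj[OF h]] h S
      by (auto simp: G_def continuous_map_in_subtopology intro: continuous_map_from_subtopology)
    then show ?thesis
      unfolding unit_cube_def continuous_map_componentwise by (auto simp: G_def)
  qed
  have "continuous_map (subtopology P (F ` topspace V)) (unit_cube X) G"
    using F01 by (intro contG) (simp add: tV)
  then have "continuous_map (subtopology P (F ` topspace V)) V G"
    using GF by (auto simp: V_cube continuous_map_in_subtopology)
  then show "embedding_map V P F"
    unfolding embedding_map_def homeomorphic_map_maps homeomorphic_maps_def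
    using contF GF by (intro exI[of _ G]) (auto simp: continuous_map_in_subtopology tV)

  have "q \<in> F ` topspace V" if q: "q \<in> P closure_of (F ` topspace V)" for q
  proof -
    have FVP: "F ` hewitt X \<subseteq> topspace P"
      using continuous_map_image_subset_topspace[OF contF] by (simp add: tV)
    have qP: "q \<in> topspace P"
      using q closure_of_subset_topspace[of P] by blast
    define S where "S = P closure_of (F ` hewitt X)"
    have "S \<subseteq> {r \<in> topspace P. r (\<lambda>v. v h) \<in> {0..1}}" if h: "h \<in> unit_maps X" for h
    proof -
      have "closedin P {r \<in> topspace P. r (\<lambda>v. v h) \<in> {0..1}}"
        using closedin_continuous_map_preimage[OF coord[OF proj[OF h]], of "{0..1}"] by simp
      moreover have "F ` hewitt X \<subseteq> {r \<in> topspace P. r (\<lambda>v. v h) \<in> {0..1}}"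
        using F01[OF _ h] FVP by auto
      ultimately show ?thesis
        unfolding S_def by (intro closure_of_minimal)
    qed
    then have S01: "\<forall>r\<in>S. \<forall>h\<in>unit_maps X. r (\<lambda>v. v h) \<in> {0..1}"
      by (simp add: subset_iff)
    define p where "p = G q"
    have "continuous_map (subtopology P S) (unit_cube X) G"
      using S01 by (rule contG)
    then have "G ` (subtopology P S closure_of (F ` hewitt X)) \<subseteq> unit_cube X closure_of (G ` F ` hewitt X)"
      by (rule continuous_map_image_closure_subset)
    moreover have "F ` hewitt X \<subseteq> S"
      unfolding S_def using FVP by (rule closure_of_subset)
    moreover have "q \<in> S"
      using q by (simp add: S_def tV)
    moreover have "G ` F ` hewitt X = hewitt X"
      using GF by force
    ultimately have "p \<in> unit_cube X closure_of hewitt X"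
      by (auto simp: p_def closure_of_subtopology inf.absorb2 S_def)
    also have "\<dots> \<subseteq> topspace (stone_cech X)"
      using hewitt_subset[of X] unfolding topspace_stone_cech
      by (simp add: closure_of_minimal)
    finally have p: "p \<in> topspace (stone_cech X)" .
    have dense: "stone_cech X closure_of hewitt X = topspace (stone_cech X)"
      using closure_of_mono[OF sc_image_subset_hewitt, of "stone_cech X" X] sc_image_dense[of X]
        closure_of_subset_topspace[of "stone_cech X"] by blast
    have near: "\<exists>U. openin (stone_cech X) U \<and> p \<in> U \<and> (\<forall>v\<in>U \<inter> hewitt X. \<bar>f v - q f\<bar> < e)"
      if f: "f \<in> C" and e: "e > 0" for f and e :: real
    proof -
      have contf: "continuous_map V euclideanreal f"
        using f by (simp add: C_def)
      define k where "k = (\<lambda>v. min (\<bar>f v - q f\<bar> / e) 1)"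
      have contk: "continuous_map V euclideanreal k"
        unfolding k_def using e
        by (intro continuous_map_real_min continuous_map_real_divide continuous_map_real_abs
            continuous_map_diff contf continuous_map_const[THEN iffD2]) auto
      define h where "h = restrict (k \<circ> sc_embed X) (topspace X)"
      have "continuous_map X V (sc_embed X)"
        using sc_image_subset_hewitt[of X]
        by (auto simp: V_def continuous_map_in_subtopology continuous_map_sc_embed)
      then have "continuous_map X euclideanreal (k \<circ> sc_embed X)"
        using contk by (rule continuous_map_compose)
      then have "continuous_map X (top_of_set {0..1}) (k \<circ> sc_embed X)"
        using e by (auto simp: continuous_map_in_subtopology k_def)
      then have h: "h \<in> unit_maps X"
        by (auto simp: unit_maps_def h_def intro: continuous_map_eq)
      have vh: "v h = k v" if v: "v \<in> hewitt X" for v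
      proof (rule forall_in_closure_of_eq[of v V "sc_image X" euclideanreal])
        show "v \<in> V closure_of sc_image X"
          using v hewitt_subset[of X] sc_image_subset_hewitt[of X] sc_image_dense[of X]
          by (auto simp: V_def closure_of_subtopology inf.absorb2)
        show "continuous_map V euclideanreal (\<lambda>v. v h)"
          using proj[OF h] by (simp add: C_def)
        show "x h = k x" if x: "x \<in> sc_image X" for x
          using x h by (auto simp: sc_embed_def h_def)
      qed (use contk in auto)
      have "q (\<lambda>v. v h) = min (\<bar>q f - q f\<bar> / e) 1"
      proof (rule forall_in_closure_of_eq[OF q, of euclideanreal "\<lambda>r. r (\<lambda>v. v h)" "\<lambda>r. min (\<bar>r f - q f\<bar> / e) 1"])
        show "continuous_map P euclideanreal (\<lambda>r. min (\<bar>r f - q f\<bar> / e) 1)"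
          using e
          by (intro continuous_map_real_min continuous_map_real_divide continuous_map_real_abs
            continuous_map_diff coord f continuous_map_const[THEN iffD2]) auto
        show "x (\<lambda>v. v h) = min (\<bar>x f - q f\<bar> / e) 1" if x: "x \<in> F ` topspace V" for x
          using x vh f proj[OF h] by (auto simp: tV F_def k_def)
      qed (use coord proj h in auto)
      then have "p h = 0"
        using h by (simp add: p_def G_def)
      moreover have "openin (stone_cech X) {v \<in> topspace (stone_cech X). v h \<in> {..<1}}"
        by (rule openin_continuous_map_preimage[OF proj_sc[OF h]]) auto
      moreover have "\<bar>f v - q f\<bar> < e" if "v \<in> hewitt X" "v h < 1" for v
        using vh[OF that(1)] that(2) e by (auto simp: k_def min_def field_simps split: if_splits)
      ultimately show ?thesis
        using p by (intro exI[of _ "{v \<in> topspace (stone_cech X). v h \<in> {..<1}}"]) auto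
    qed
    have pV: "p \<in> hewitt X"
    proof -
      have sub: "hewitt X \<subseteq> insert p (hewitt X)" "insert p (hewitt X) \<subseteq> stone_cech X closure_of hewitt X"
        using dense p hewitt_subset[of X] by auto
      have "C_embedded_in (subtopology (stone_cech X) (insert p (hewitt X))) (sc_image X)"
        unfolding C_embedded_in_def
      proof (intro conjI allI impI)
        show "sc_image X \<subseteq> topspace (subtopology (stone_cech X) (insert p (hewitt X)))"
          using sc_image_subset[of X] sc_image_subset_hewitt[of X] by auto
      next
        fix f
        assume "continuous_map (subtopology (subtopology (stone_cech X) (insert p (hewitt X))) (sc_image X))
                  euclideanreal f"
        then have "continuous_map (subtopology (subtopology (stone_cech X) (hewitt X)) (sc_image X))
                     euclideanreal f"
          using sc_image_subset_hewitt[of X]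
          by (simp add: subtopology_subtopology inf.absorb2 subset_insertI2)
        then obtain g where g: "continuous_map V euclideanreal g" "\<forall>y\<in>sc_image X. g y = f y"
          using C_embedded_in_hewitt[of X] unfolding C_embedded_in_def V_def by blast
        have "limitin euclideanreal g (q g) (atin_within (stone_cech X) t (hewitt X))"
          if "t \<in> insert p (hewitt X) - hewitt X" for t
        proof -
          have t: "t = p"
            using that by auto
          show ?thesis
            unfolding limitin_def eventually_atin_within
          proof (intro conjI allI impI disjI2)
            fix W :: "real set"
            assume "openin euclidean W \<and> q g \<in> W"
            then obtain e where e: "e > 0" "\<And>y. \<bar>y - q g\<bar> < e \<Longrightarrow> y \<in> W"
              by (auto simp: open_real)
            obtain U where "openin (stone_cech X) U" "p \<in> U" "\<forall>v\<in>U \<inter> hewitt X. \<bar>g v - q g\<bar> < e"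
              using near[of g e] g(1) e(1) by (auto simp: C_def)
            then show "\<exists>T. openin (stone_cech X) T \<and> t \<in> T \<and> (\<forall>x\<in>T. x \<in> hewitt X \<and> x \<noteq> t \<longrightarrow> g x \<in> W)"
              using e(2) t by (intro exI[of _ U]) auto
          qed auto
        qed
        then obtain g' where "continuous_map (subtopology (stone_cech X) (insert p (hewitt X))) euclideanreal g'"
          "\<And>x. x \<in> hewitt X \<Longrightarrow> g' x = g x"
          using continuous_map_extension_pointwise_alt[OF _ sub, of euclideanreal g] g(1)
          unfolding V_def by (metis regular_space_euclidean)
        then show "\<exists>g. continuous_map (subtopology (stone_cech X) (insert p (hewitt X))) euclideanreal g \<and>
                       (\<forall>y\<in>sc_image X. g y = f y)"
          using g(2) sc_image_subset_hewitt[of X] by (metis subsetD)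
      qed
      then show ?thesis
        using p hewitt_subset[of X] sc_image_subset_hewitt[of X]
          C_embedded_in_iff_hewitt[of X "insert p (hewitt X)"] by auto
    qed
    have "q f = f p" if f: "f \<in> C" for f
    proof (rule ccontr)
      assume "q f \<noteq> f p"
      then show False
        using near[OF f, of "\<bar>f p - q f\<bar>"] pV by auto
    qed
    moreover have "q \<in> extensional C"
      using qP by (auto simp: P_def PiE_def)
    ultimately have "q = F p"
      by (auto simp: F_def fun_eq_iff extensional_def)
    then show ?thesis
      using pV by (auto simp: tV)
  qed
  then show "closedin P (F ` topspace V)"
    using continuous_map_image_subset_topspace[OF contF]
    by (metis closure_of_eq closure_of_subset subsetI subset_antisym)
qed

end

theory Submission
  imports Defs
begin

text \<open>Write \<open>B\<close> for the compactification, \<open>V\<close> for the Hewitt realcompactification, and \<open>K\<close> for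
  the closure of \<open>V - X\<close> in \<open>B\<close>. Near pseudocompactness says that \<open>K\<close> contains the whole
  remainder \<open>B - X\<close>, that is, \<open>X \<union> K = B\<close>.

  If \<open>X \<union> K = B\<close>, a hard subspace is closed in a compact space, hence compact, and an infinite
  discrete space is not.

  Conversely, suppose that some point \<open>p\<close> of \<open>B - X\<close> is not in \<open>K\<close>. Then \<open>p\<close> is not in \<open>V\<close>, so some
  real function on \<open>X\<close> does not extend to \<open>p\<close>; bounding it with the arctangent turns it into a
  continuous function on \<open>B\<close> that vanishes at \<open>p\<close> and is positive on \<open>X\<close>
  (\<open>positive_map_vanishing_off_hewitt\<close>). The maximum of this function and of one that vanishes at
  \<open>p\<close> and is \<open>1\<close> on \<open>K\<close> is positive on \<open>X \<union> K\<close>, so its reciprocal \<open>g\<close> is continuous on \<open>X \<union> K\<close>. As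
  \<open>X\<close> is dense, \<open>g\<close> is unbounded on \<open>X\<close>. A sequence in \<open>X\<close> along which \<open>g\<close> grows by at least \<open>1\<close> at
  each step is the required copy of the natural numbers: a function on it factors through \<open>g\<close> and
  Tietze's theorem on the line extends it to \<open>X\<close>, while continuity of \<open>g\<close> on all of \<open>X \<union> K\<close>
  keeps the sequence from accumulating in \<open>X \<union> K\<close>, so that it is hard.\<close>

section \<open>Sequences along which a real function grows in unit steps\<close>

lemma unit_steps_gap:
  fixes t :: "nat \<Rightarrow> real"
  assumes step: "\<And>n. t n + 1 \<le> t (Suc n)" and "m < n"
  shows "t m + 1 \<le> t n"
  using \<open>m < n\<close>
proof (induction n)
  case (Suc n)
  then show ?case
    using step[of n] by (cases "m = n") auto
qed simp

lemma unit_steps_separated: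
  fixes t :: "nat \<Rightarrow> real"
  assumes step: "\<And>n. t n + 1 \<le> t (Suc n)" and "\<bar>t m - t n\<bar> < 1"
  shows "m = n"
proof (cases m n rule: linorder_cases)
  case less
  then show ?thesis
    using unit_steps_gap[of t, OF step less] assms(2) by linarith
next
  case greater
  then show ?thesis
    using unit_steps_gap[of t, OF step greater] assms(2) by linarith
qed

lemma unit_steps_finite_below:
  fixes t :: "nat \<Rightarrow> real"
  assumes step: "\<And>n. t n + 1 \<le> t (Suc n)"
  shows "finite {n. t n < c}"
proof -
  have "t 0 + real n \<le> t n" for n
  proof (induction n)
    case (Suc n)
    then show ?case
      using step[of n] by simp
  qed simp
  then have "real n < c - t 0" if "t n < c" for n
    using that by (metis le_less_trans less_diff_eq add.commute)
  moreover obtain N where "c - t 0 < real N"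
    using reals_Archimedean2 by blast
  ultimately have "{n. t n < c} \<subseteq> {..<N}"
    by (force dest: less_trans)
  then show ?thesis
    using finite_subset by blast
qed

lemma unit_steps_homeomorphic_nat:
  assumes cont: "continuous_map X euclideanreal \<phi>" and x: "range x \<subseteq> topspace X"
    and step: "\<And>n. \<phi> (x n) + 1 \<le> \<phi> (x (Suc n))"
  shows "subtopology X (range x) homeomorphic_space discrete_topology (UNIV :: nat set)"
proof -
  have inj: "inj x"
    using unit_steps_separated[of "\<lambda>n. \<phi> (x n)", OF step] by (auto intro!: injI)
  have "openin (subtopology X (range x)) {x n}" for n
  proof -
    have "openin X {y \<in> topspace X. \<phi> y \<in> ball (\<phi> (x n)) 1}"
      by (rule openin_continuous_map_preimage[OF cont]) auto
    moreover have "{x n} = {y \<in> topspace X. \<phi> y \<in> ball (\<phi> (x n)) 1} \<inter> range x"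
      using x unit_steps_separated[of "\<lambda>n. \<phi> (x n)", OF step] by (auto simp: dist_real_def)
    ultimately show ?thesis
      unfolding openin_subtopology by blast
  qed
  then have disc: "subtopology X (range x) = discrete_topology (range x)"
    using x by (subst eq_commute) (auto simp: discrete_topology_unique inf.absorb2)
  have "homeomorphic_map (discrete_topology UNIV) (discrete_topology (range x)) x"
    using inj by (auto simp: homeomorphic_eq_everything_map open_map_def closed_map_def)
  then show ?thesis
    using disc by (metis homeomorphic_map_imp_homeomorphic_space homeomorphic_space_sym)
qed

text \<open>The values of \<open>\<phi>\<close> along the sequence form a closed discrete set of reals, so a function on the
  sequence is a function of these values, and Tietze's theorem extends the latter to the line.\<close>

lemma unit_steps_C_embedded:
  assumes cont: "continuous_map X euclideanreal \<phi>" and x: "range x \<subseteq> topspace X"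
    and step: "\<And>n. \<phi> (x n) + 1 \<le> \<phi> (x (Suc n))"
  shows "C_embedded_in X (range x)"
  unfolding C_embedded_in_def
proof (intro conjI allI impI x)
  fix f :: "'a \<Rightarrow> real"
  define t where "t = (\<lambda>n. \<phi> (x n))"
  have sep: "m = n" if "\<bar>t m - t n\<bar> < 1" for m n
    using unit_steps_separated[of t] step that by (simp add: t_def)
  have "inj t"
    using sep by (auto intro!: injI)
  have "uniform_discrete (range t)"
    unfolding uniform_discrete_def using sep by (intro exI[of _ 1]) (auto simp: dist_real_def)
  moreover have "closed (range t)"
    using sep by (intro discrete_imp_closed[of 1]) (auto simp: dist_real_def)
  ultimately have "continuous_on (range t) (\<lambda>s. f (x (inv t s)))" "closedin (top_of_set UNIV) (range t)"
    by (simp_all add: Isolated.continuous_on_discrete uniform_discrete_imp_discrete)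
  then obtain \<psi> where \<psi>: "continuous_on UNIV \<psi>" "\<And>s. s \<in> range t \<Longrightarrow> \<psi> s = f (x (inv t s))"
    using Tietze_unbounded by blast
  have "continuous_map X euclideanreal (\<psi> \<circ> \<phi>)"
    using cont \<psi>(1) by (auto intro: continuous_map_compose)
  moreover have "(\<psi> \<circ> \<phi>) (x n) = f (x n)" for n
    using \<psi>(2)[of "t n"] inv_f_f[OF \<open>inj t\<close>, of n] by (simp add: t_def)
  ultimately show "\<exists>g. continuous_map X euclideanreal g \<and> (\<forall>y\<in>range x. g y = f y)"
    by blast
qed

text \<open>The function is locally bounded, so every point has a neighbourhood that meets the sequence in
  finitely many points.\<close>

lemma unit_steps_closedin:
  assumes "Hausdorff_space Y" and cont: "continuous_map Y euclideanreal \<phi>"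
    and x: "range x \<subseteq> topspace Y" and step: "\<And>n. \<phi> (x n) + 1 \<le> \<phi> (x (Suc n))"
  shows "closedin Y (range x)"
proof -
  have "locally_finite_in Y ((\<lambda>n. {x n}) ` UNIV)"
    unfolding locally_finite_in_def
  proof (intro conjI ballI)
    fix y
    assume y: "y \<in> topspace Y"
    let ?V = "{z \<in> topspace Y. \<phi> z \<in> {..<\<phi> y + 1}}"
    have "openin Y ?V"
      by (rule openin_continuous_map_preimage[OF cont]) auto
    moreover have "{U \<in> (\<lambda>n. {x n}) ` UNIV. U \<inter> ?V \<noteq> {}} \<subseteq> (\<lambda>n. {x n}) ` {n. \<phi> (x n) < \<phi> y + 1}"
      by auto
    then have "finite {U \<in> (\<lambda>n. {x n}) ` UNIV. U \<inter> ?V \<noteq> {}}"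
      using unit_steps_finite_below[of "\<lambda>n. \<phi> (x n)", OF step] by (meson finite_imageI finite_subset)
    ultimately show "\<exists>V. openin Y V \<and> y \<in> V \<and> finite {U \<in> (\<lambda>n. {x n}) ` UNIV. U \<inter> V \<noteq> {}}"
      using y by (intro exI[of _ ?V]) auto
  qed (use x in auto)
  then have "closedin Y (\<Union>((\<lambda>n. {x n}) ` UNIV))"
    using assms by (intro closedin_locally_finite_Union) (auto simp: closedin_Hausdorff_sing_eq)
  then show ?thesis
    by (simp add: UNION_singleton_eq_range)
qed

lemma unbounded_obtains_unit_steps:
  fixes \<phi> :: "'a \<Rightarrow> real"
  assumes unb: "\<And>c. \<exists>y\<in>S. c < \<phi> y"
  obtains x where "range x \<subseteq> S" "\<And>n::nat. \<phi> (x n) + 1 \<le> \<phi> (x (Suc n))"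
proof -
  have "\<exists>x. \<forall>n::nat. x n \<in> S \<and> \<phi> (x n) + 1 \<le> \<phi> (x (Suc n))"
    using unb by (intro dependent_nat_choice) (force intro: less_imp_le)+
  then show thesis
    using that by blast
qed


section \<open>Points outside the Hewitt realcompactification\<close>

text \<open>Take \<open>f\<close> on \<open>X\<close> without a continuous extension to \<open>p\<close>, and let \<open>F\<close> be the extension of
  \<open>arctan f\<close> to the compactification. If \<open>cos (F p)\<close> were nonzero, then \<open>tan F\<close> would be a
  continuous extension of \<open>f\<close> to \<open>p\<close>.\<close>

lemma positive_map_vanishing_off_hewitt:
  assumes p: "p \<in> topspace (stone_cech X)" "p \<notin> hewitt X"
  obtains h where "continuous_map (stone_cech X) euclideanreal h" "h p = 0"
    "\<And>v. v \<in> sc_image X \<Longrightarrow> 0 < h v"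
proof -
  let ?B = "stone_cech X"
  let ?T = "insert p (sc_image X)"
  have "\<not> C_embedded_in (subtopology ?B ?T) (sc_image X)"
    using C_embedded_in_iff_hewitt[of X ?T] p sc_image_subset[of X] by auto
  then obtain f where f: "continuous_map (subtopology ?B (sc_image X)) euclideanreal f"
    and noext: "\<And>g. continuous_map (subtopology ?B ?T) euclideanreal g \<Longrightarrow> \<exists>y\<in>sc_image X. g y \<noteq> f y"
    using p sc_image_subset[of X]
    by (auto simp: C_embedded_in_def subtopology_subtopology inf.absorb2 subset_insertI)
  have "continuous_map X (subtopology ?B (sc_image X)) (sc_embed X)"
    by (auto simp: continuous_map_in_subtopology continuous_map_sc_embed)
  then have "continuous_map X euclideanreal (f \<circ> sc_embed X)"
    using f by (rule continuous_map_compose)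
  moreover have "continuous_map euclideanreal euclideanreal arctan"
    by (simp add: continuous_intros)
  ultimately have "continuous_map X euclideanreal (arctan \<circ> (f \<circ> sc_embed X))"
    by (rule continuous_map_compose)
  then have "continuous_map X (top_of_set {-(pi/2)..pi/2}) (arctan \<circ> (f \<circ> sc_embed X))"
    using arctan_bounded by (simp add: continuous_map_in_subtopology less_imp_le)
  moreover have "compact_space (top_of_set {-(pi/2)..pi/2})"
    by (simp add: compact_space_subtopology)
  moreover have "Hausdorff_space (top_of_set {-(pi/2)..pi/2})"
    by (simp add: Hausdorff_space_subtopology)
  ultimately obtain F where F: "continuous_map ?B (top_of_set {-(pi/2)..pi/2}) F"
    and "\<And>x. x \<in> topspace X \<Longrightarrow> F (sc_embed X x) = (arctan \<circ> (f \<circ> sc_embed X)) x"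
    using stone_cech_extension by blast
  then have Fx: "F v = arctan (f v)" if "v \<in> sc_image X" for v
    using that by auto
  have cF: "continuous_map ?B euclideanreal F"
    using F by (simp add: continuous_map_in_subtopology)
  have trig: "continuous_map ?B euclideanreal (\<lambda>v. cos (F v))"
    "continuous_map ?B euclideanreal (\<lambda>v. sin (F v))"
    using continuous_map_compose[OF cF, of euclideanreal cos]
      continuous_map_compose[OF cF, of euclideanreal sin]
    by (simp_all add: comp_def continuous_intros)
  have pos: "0 < cos (F v)" if "v \<in> sc_image X" for v
    using that Fx arctan_lbound arctan_ubound by (simp add: cos_gt_zero_pi)
  have "cos (F p) = 0"
  proof (rule ccontr)
    assume "cos (F p) \<noteq> 0"
    then have "continuous_map (subtopology ?B ?T) euclideanreal (\<lambda>v. sin (F v) / cos (F v))"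
      using trig pos
      by (intro continuous_map_real_divide continuous_map_from_subtopology) force+
    moreover have "sin (F v) / cos (F v) = f v" if "v \<in> sc_image X" for v
      using Fx[OF that] tan_arctan[of "f v"] by (simp add: tan_def)
    ultimately show False
      using noext by blast
  qed
  then show thesis
    using that trig(1) pos by blast
qed


section \<open>Nearly pseudocompact spaces\<close>

lemma nearly_pseudocompact_iff:
  "nearly_pseudocompact X \<longleftrightarrow>
     topspace (stone_cech X) - sc_image X \<subseteq> stone_cech X closure_of (hewitt X - sc_image X)"
proof -
  have "(topspace (stone_cech X) - sc_image X) \<inter> (hewitt X - sc_image X) = hewitt X - sc_image X"
    using hewitt_subset[of X] by auto
  then show ?thesis
    by (auto simp: nearly_pseudocompact_def Let_def closure_of_subtopology)
qed

text \<open>The space and \<open>K\<close> together make up the compactification, so hard means closed in it. The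
  embedding carries compactness of the image back to \<open>X\<close>.\<close>

lemma nearly_pseudocompact_hard_imp_compactin:
  assumes "tychonoff_space X" "nearly_pseudocompact X" "hard_in X D"
  shows "compactin X D"
proof -
  let ?B = "stone_cech X"
  define K where "K = ?B closure_of (hewitt X - sc_image X)"
  have D: "D \<subseteq> topspace X" "closedin (subtopology ?B (sc_image X \<union> K)) (sc_embed X ` D)"
    using assms by (auto simp: hard_in_def K_def)
  have "sc_image X \<union> K = topspace ?B"
    using assms(2) sc_image_subset[of X] closure_of_subset_topspace[of ?B]
    unfolding nearly_pseudocompact_iff K_def by blast
  then have "compactin ?B (sc_embed X ` D)"
    using D compact_space_stone_cech closedin_compact_space by fastforce
  moreover obtain k where
    k: "homeomorphic_maps X (subtopology ?B (sc_image X)) (sc_embed X) k"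
    using embedding_map_sc_embed[OF assms(1)] by (auto simp: embedding_map_def homeomorphic_map_maps)
  ultimately have "compactin X (k ` sc_embed X ` D)"
    using D by (intro image_compactin[of "subtopology ?B (sc_image X)"])
      (auto simp: compactin_subtopology homeomorphic_maps_def)
  moreover have "k (sc_embed X x) = x" if "x \<in> D" for x
    using that D k by (auto simp: homeomorphic_maps_def)
  then have "k ` sc_embed X ` D = D"
    by (simp add: image_image)
  ultimately show ?thesis
    by simp
qed

text \<open>The function with unit steps is the reciprocal of \<open>max h u\<close>, where \<open>h\<close> keeps the maximum
  positive on \<open>X\<close> and \<open>u\<close> keeps it positive on \<open>K\<close>, although both vanish at a common point \<open>p\<close>.
  Its continuity on \<open>X \<union> K\<close>, and not only on \<open>X\<close>, is what makes the sequence hard.\<close>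

lemma not_nearly_pseudocompact_imp_hard_unit_steps:
  assumes "\<not> nearly_pseudocompact X"
  obtains \<phi> and x :: "nat \<Rightarrow> 'a"
  where "continuous_map X euclideanreal \<phi>" "range x \<subseteq> topspace X"
    "\<And>n. \<phi> (x n) + 1 \<le> \<phi> (x (Suc n))" "hard_in X (range x)"
proof -
  let ?B = "stone_cech X"
  define K where "K = ?B closure_of (hewitt X - sc_image X)"
  obtain p where p: "p \<in> topspace ?B" "p \<notin> sc_image X" "p \<notin> K"
    using assms by (auto simp: nearly_pseudocompact_iff K_def)
  have "hewitt X - sc_image X \<subseteq> K"
    unfolding K_def using hewitt_subset[of X] by (intro closure_of_subset) auto
  then have "p \<notin> hewitt X"
    using p by auto
  then obtain h where h: "continuous_map ?B euclideanreal h" "h p = 0"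
    "\<And>v. v \<in> sc_image X \<Longrightarrow> 0 < h v"
    using positive_map_vanishing_off_hewitt p(1) by blast
  have "completely_regular_space ?B"
    by (simp add: compact_space_stone_cech Hausdorff_space_stone_cech
        compact_Hausdorff_or_regular_imp_normal_space normal_imp_completely_regular_space)
  moreover have "closedin ?B K"
    by (simp add: K_def)
  ultimately obtain u where u: "continuous_map ?B (top_of_set {0..1::real}) u" "u p = 0" "u ` K \<subseteq> {1}"
    using p unfolding completely_regular_space_def by (metis Diff_iff)
  define k where "k = (\<lambda>v. max (h v) (u v))"
  have k: "continuous_map ?B euclideanreal k"
    using h(1) u(1) unfolding k_def
    by (intro continuous_map_real_max) (auto simp: continuous_map_in_subtopology)
  have kpos: "0 < k v" if "v \<in> sc_image X \<union> K" for v
    using that h(3) u(3) by (force simp: k_def less_max_iff_disj)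
  define Y where "Y = subtopology ?B (sc_image X \<union> K)"
  define g where "g = (\<lambda>v. 1 / k v)"
  have tY: "topspace Y = sc_image X \<union> K"
    using sc_image_subset[of X] closure_of_subset_topspace[of ?B] by (auto simp: Y_def K_def)
  have g: "continuous_map Y euclideanreal g"
    unfolding g_def using k kpos
    by (intro continuous_map_real_divide) (force simp: Y_def tY continuous_map_from_subtopology)+
  have e: "continuous_map X Y (sc_embed X)"
    unfolding Y_def by (auto simp: continuous_map_in_subtopology continuous_map_sc_embed)
  have unb: "\<exists>x\<in>topspace X. c < (g \<circ> sc_embed X) x" for c
  proof -
    \<comment> \<open>Where \<open>k < 1 / (\<bar>c\<bar> + 1)\<close>, a neighbourhood of \<open>p\<close>, one has \<open>g > \<bar>c\<bar> + 1\<close>.\<close>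
    let ?U = "{v \<in> topspace ?B. k v \<in> {..<1 / (\<bar>c\<bar> + 1)}}"
    have "openin ?B ?U"
      by (rule openin_continuous_map_preimage[OF k]) auto
    moreover have "p \<in> ?U"
      using p h(2) u(2) by (simp add: k_def)
    moreover have "p \<in> ?B closure_of sc_image X"
      using p by (simp add: sc_image_dense)
    ultimately have "\<exists>v. v \<in> sc_image X \<and> v \<in> ?U"
      unfolding in_closure_of by (elim conjE allE[of _ ?U]) simp
    then obtain x where x: "x \<in> topspace X" "sc_embed X x \<in> ?U"
      by blast
    then have "0 < k (sc_embed X x)" "k (sc_embed X x) < 1 / (\<bar>c\<bar> + 1)"
      using kpos by auto
    then have "\<bar>c\<bar> + 1 < g (sc_embed X x)"
      by (simp add: g_def field_simps)
    then show ?thesis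
      using x by (intro bexI[of _ x]) auto
  qed
  obtain x where x: "range x \<subseteq> topspace X"
    "\<And>n::nat. (g \<circ> sc_embed X) (x n) + 1 \<le> (g \<circ> sc_embed X) (x (Suc n))"
    using unbounded_obtains_unit_steps[OF unb] by blast
  have "closedin Y (range (sc_embed X \<circ> x))"
  proof (rule unit_steps_closedin[OF _ g])
    show "Hausdorff_space Y"
      by (simp add: Y_def Hausdorff_space_subtopology Hausdorff_space_stone_cech)
    show "range (sc_embed X \<circ> x) \<subseteq> topspace Y"
      using x(1) by (auto simp: tY)
    show "g ((sc_embed X \<circ> x) n) + 1 \<le> g ((sc_embed X \<circ> x) (Suc n))" for n
      using x(2)[of n] by simp
  qed
  then have "hard_in X (range x)"
    using x(1) by (simp add: hard_in_def Y_def K_def image_comp)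
  then show thesis
    using that x continuous_map_compose[OF e g] by blast
qed

theorem theorem7:
  fixes X :: "'a topology"
  assumes "tychonoff_space X"
  shows "nearly_pseudocompact X \<longleftrightarrow>
    \<not> (\<exists>D. D \<subseteq> topspace X \<and>
           subtopology X D homeomorphic_space discrete_topology (UNIV :: nat set) \<and>
           C_embedded_in X D \<and> hard_in X D)"
proof
  assume np: "nearly_pseudocompact X"
  have False
    if hom: "subtopology X D homeomorphic_space discrete_topology (UNIV :: nat set)"
      and hard: "hard_in X D" for D
  proof -
    have "compact_space (subtopology X D)"
      using nearly_pseudocompact_hard_imp_compactin[OF assms np hard] by (simp add: compactin_subspace)
    then have "compact_space (discrete_topology (UNIV :: nat set))"
      using homeomorphic_compact_space[OF hom] by simp
    then show False
      by (simp add: compact_space_discrete_topology)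
  qed
  then show "\<not> (\<exists>D. D \<subseteq> topspace X \<and>
           subtopology X D homeomorphic_space discrete_topology (UNIV :: nat set) \<and>
           C_embedded_in X D \<and> hard_in X D)"
    by blast
next
  assume no_copy: "\<not> (\<exists>D. D \<subseteq> topspace X \<and>
           subtopology X D homeomorphic_space discrete_topology (UNIV :: nat set) \<and>
           C_embedded_in X D \<and> hard_in X D)"
  show "nearly_pseudocompact X"
  proof (rule ccontr)
    assume "\<not> nearly_pseudocompact X"
    then obtain \<phi> and x :: "nat \<Rightarrow> 'a"
      where "continuous_map X euclideanreal \<phi>" "range x \<subseteq> topspace X"
        "\<And>n. \<phi> (x n) + 1 \<le> \<phi> (x (Suc n))" "hard_in X (range x)"
      using not_nearly_pseudocompact_imp_hard_unit_steps by blast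
    then show False
      using no_copy unit_steps_homeomorphic_nat unit_steps_C_embedded by blast
  qed
qed

end
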